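(* For $m\geq 1$ and $0\le i\le m$ let $$T(m,i)=\frac{4m^2+7m+3+i\sqrt{4m+4i^2+1}-2i^2}{2(m-i+1)(m+1)}.$$ Then for all $m\geq 2$ and $1\leq i\leq m-1$, $$\frac{d_i(m+1)}{d_i(m)}<T(m,i),$$ and for all $m\geq 1$, $$\frac{d_0(m+1)}{d_0(m)}=T(m,0),\qquad \frac{d_m(m+1)}{d_m(m)}=T(m,m).$$
   Context: For integers $m\geq 0$, the Boros-Moll polynomial is $P_m(a)=2^{-2m}\sum_{k}2^k\binom{2m-2k}{m-k}\binom{m+k}{k}(a+1)^k=\sum_{i=0}^m d_i(m)a^i$, so that $d_i(m)=2^{-2m}\sum_{k=0}^m 2^k\binom{2m-2k}{m-k}\binom{m+k}{m}\binom{k}{i}$ for $0\le i\le m$. These coefficients are positive. *)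

theory Defs
  imports Complex_Main "HOL-Computational_Algebra.Polynomial"
begin

definition boros_moll_poly :: "nat \<Rightarrow> real poly" where
  "boros_moll_poly m =
     smult (1 / 2 ^ (2 * m))
       (\<Sum>k=0..m. smult (2 ^ k * real ((2 * m - 2 * k) choose (m - k)) * real ((m + k) choose k))
          ([:1, 1:] ^ k))"

text \<open>The argument order follows the notation $d_i(m)$: index first, then degree.\<close>

definition boros_moll_coeff :: "nat \<Rightarrow> nat \<Rightarrow> real" where
  "boros_moll_coeff i m = coeff (boros_moll_poly m) i"

definition T_bound :: "nat \<Rightarrow> nat \<Rightarrow> real" where
  "T_bound m i =
     (4 * real m ^ 2 + 7 * real m + 3 + real i * sqrt (4 * real m + 4 * real i ^ 2 + 1)
        - 2 * real i ^ 2)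
     / (2 * (real m - real i + 1) * (real m + 1))"

lemma coeff_one_plus_X_power: "coeff ([:1, 1:] ^ k :: real poly) i = real (k choose i)"
proof (induction k arbitrary: i)
  case 0
  then show ?case by (cases i) (simp_all add: binomial_eq_0)
next
  case (Suc k)
  then show ?case by (cases i) simp_all
qed

lemma boros_moll_coeff_explicit:
  "boros_moll_coeff i m =
     1 / 2 ^ (2 * m) *
     (\<Sum>k=0..m. 2 ^ k * real ((2 * m - 2 * k) choose (m - k)) * real ((m + k) choose m)
        * real (k choose i))"
proof -
  have "(m + k) choose k = (m + k) choose m" for k
    using binomial_symmetric[of k "m + k"] by simp
  then show ?thesis
    by (simp add: boros_moll_coeff_def boros_moll_poly_def coeff_sum coeff_one_plus_X_power)
qed

lemma boros_moll_coeff_pos: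
  assumes "i \<le> m"
  shows "boros_moll_coeff i m > 0"
proof -
  have "0 < (\<Sum>k=0..m. 2 ^ k * real ((2 * m - 2 * k) choose (m - k)) * real ((m + k) choose m)
        * real (k choose i))"
    by (rule sum_pos2[of _ m]) (use assms in auto)
  then show ?thesis by (simp add: boros_moll_coeff_explicit)
qed

end

theory Submission
  imports Defs
begin

text \<open>
  Write $P_m(a) = Q_m(a + 1)$. The coefficients of $Q_m$ are hypergeometric in both indices, which
  yields recurrences expressing $d_{i+1}(m+1)$ and $d_i(m+1)$ through $d_i(m)$ and $d_{i+1}(m)$.
  The one for $d_i(m+1)$ gives the two boundary values of the ratio, since $d_{m+1}(m) = 0$. Eliminating $d_{i+1}$ gives a
  three-term recurrence in $m$, that is $r(m+1) = A(m) - B(m)/r(m)$ with $B > 0$ for the ratio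
  $r(m) = d_i(m+1)/d_i(m)$. Hence the bound propagates from $m$ to $m+1$, starting from the equality
  at $m = i$, as soon as $A(m) - B(m)/T(m,i) < T(m+1,i)$. After clearing denominators this
  involves only $s = \sqrt{4m+4i^2+1}$ and $s' = \sqrt{4m+4i^2+5}$, and the estimate
  $s < s' - 2/s'$ suffices.
\<close>

section \<open>Recurrences for the coefficients\<close>

text \<open>The coefficient of x^k in Q_m(x), where x stands for a + 1. The guard matters: for k > m
  truncated subtraction would make \<open>m - k\<close> zero and leave a nonzero value.\<close>

definition shifted_coeff :: "nat \<Rightarrow> nat \<Rightarrow> real" where
  "shifted_coeff m k =
     (if k \<le> m
      then 2 ^ k / 4 ^ m * real ((2 * (m - k)) choose (m - k)) * real ((m + k) choose k)
      else 0)"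

definition shifted_poly :: "nat \<Rightarrow> real poly" where
  "shifted_poly m = (\<Sum>k\<le>m. monom (shifted_coeff m k) k)"

lemma coeff_shifted_poly: "coeff (shifted_poly m) k = shifted_coeff m k"
  by (auto simp: shifted_poly_def coeff_sum shifted_coeff_def sum.delta' if_distrib
           cong: if_cong)

lemma pcompose_monom: "pcompose (monom c k) q = smult c (q ^ k)"
  for c :: "'a :: comm_semiring_1"
  by (induction k) (simp_all add: monom_0 monom_Suc pcompose_pCons)

lemma boros_moll_poly_eq_pcompose:
  "boros_moll_poly m = pcompose (shifted_poly m) [:1, 1:]"
  by (intro poly_eqI)
     (auto simp: boros_moll_poly_def shifted_poly_def pcompose_sum pcompose_monom coeff_sum
        sum_distrib_left shifted_coeff_def power_mult diff_mult_distrib2 atLeast0AtMost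
        intro!: sum.cong)

section \<open>Hypergeometric recurrences for the coefficients of Q_m\<close>

lemma central_binomial_Suc:
  "(real n + 1) * real ((2 * Suc n) choose Suc n) = 2 * (2 * real n + 1) * real ((2 * n) choose n)"
proof -
  have "Suc n * ((2 * Suc n) choose Suc n) = (2 * n + 2) * (Suc (2 * n) choose n)"
    using Suc_times_binomial_eq[of "Suc (2 * n)" n] by (simp add: mult.commute)
  moreover have "Suc n * (Suc (2 * n) choose n) = Suc (2 * n) * ((2 * n) choose n)"
    using Suc_times_binomial_eq[of "2 * n" n] binomial_symmetric[of n "Suc (2 * n)"]
    by (simp add: mult.commute)
  ultimately have "Suc n * ((2 * Suc n) choose Suc n) = 2 * (Suc (2 * n) * ((2 * n) choose n))"
    by simp
  then have "real (Suc n * ((2 * Suc n) choose Suc n)) = real (2 * (Suc (2 * n) * ((2 * n) choose n)))"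
    by (simp only:)
  then show ?thesis by (simp add: algebra_simps)
qed

lemma binomial_add_Suc_left:
  "(real m + 1) * real ((Suc m + k) choose k) = (real m + real k + 1) * real ((m + k) choose k)"
proof -
  have "Suc m * (Suc (m + k) choose Suc m) = Suc (m + k) * ((m + k) choose m)"
    using Suc_times_binomial_eq[of "m + k" m] by (simp add: mult.commute)
  then have "Suc m * ((Suc m + k) choose k) = Suc (m + k) * ((m + k) choose k)"
    using binomial_symmetric[of k "Suc m + k"] binomial_symmetric[of k "m + k"] by simp
  then have "real (Suc m * ((Suc m + k) choose k)) = real (Suc (m + k) * ((m + k) choose k))"
    by (simp only:)
  then show ?thesis by (simp add: algebra_simps)
qed

lemma binomial_add_Suc_right:
  "(real k + 1) * real ((m + Suc k) choose Suc k) = (real m + real k + 1) * real ((m + k) choose k)"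
proof -
  have "Suc k * ((m + Suc k) choose Suc k) = Suc (m + k) * ((m + k) choose k)"
    using Suc_times_binomial_eq[of "m + k" k] by (simp add: mult.commute)
  then have "real (Suc k * ((m + Suc k) choose Suc k)) = real (Suc (m + k) * ((m + k) choose k))"
    by (simp only:)
  then show ?thesis by (simp add: algebra_simps)
qed

text \<open>With j = m - k, the quotient of the two coefficients is 1/4 times 2(2j+1)/(j+1) from the
  central binomial times (m+k+1)/(m+1) from the other one. Clearing denominators extends this to k >
  m: at k = m + 1 the factor m + 1 - k removes the only nonzero value.\<close>

lemma shifted_coeff_Suc_left:
  "2 * (real m + 1) * (real m + 1 - real k) * shifted_coeff (Suc m) k
     = (2 * real m - 2 * real k + 1) * (real m + real k + 1) * shifted_coeff m k"
proof (cases "k \<le> m")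
  case True
  define j where "j = m - k"
  have m: "m = j + k" using True by (simp add: j_def)
  define x where "x = real ((2 * Suc j) choose Suc j)"
  define y where "y = real ((2 * j) choose j)"
  define u where "u = real ((Suc m + k) choose k)"
  define v where "v = real ((m + k) choose k)"
  have x: "(real j + 1) * x = 2 * (2 * real j + 1) * y"
    unfolding x_def y_def by (rule central_binomial_Suc)
  have u: "(real m + 1) * u = (real m + real k + 1) * v"
    unfolding u_def v_def by (rule binomial_add_Suc_left)
  have "2 * (real m + 1) * (real m + 1 - real k) * shifted_coeff (Suc m) k
      = 2 ^ k / (2 * 4 ^ m) * ((real j + 1) * x) * ((real m + 1) * u)"
    using True by (simp add: shifted_coeff_def x_def u_def Suc_diff_le j_def of_nat_diff field_simps)
  also have "\<dots> = (2 * real j + 1) * (real m + real k + 1) * (2 ^ k / 4 ^ m * y * v)"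
    unfolding x u by (simp add: field_simps)
  also have "2 ^ k / 4 ^ m * y * v = shifted_coeff m k"
    using True by (simp add: shifted_coeff_def y_def v_def j_def)
  finally show ?thesis by (simp add: m algebra_simps)
next
  case False
  then show ?thesis by (cases "k = Suc m") (simp_all add: shifted_coeff_def)
qed

text \<open>The quotient in the k direction, cleared of denominators in the same way; the factor m -
  k takes care of k = m.\<close>

lemma shifted_coeff_Suc_right:
  "(real k + 1) * (2 * real m - 2 * real k - 1) * shifted_coeff m (Suc k)
     = (real m - real k) * (real m + real k + 1) * shifted_coeff m k"
proof (cases "Suc k \<le> m")
  case True
  define j where "j = m - Suc k"
  have m: "m = Suc j + k" using True by (simp add: j_def)
  define x where "x = real ((2 * Suc j) choose Suc j)"
  define y where "y = real ((2 * j) choose j)"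
  define u where "u = real ((m + Suc k) choose Suc k)"
  define v where "v = real ((m + k) choose k)"
  have x: "(real j + 1) * x = 2 * (2 * real j + 1) * y"
    unfolding x_def y_def by (rule central_binomial_Suc)
  have u: "(real k + 1) * u = (real m + real k + 1) * v"
    unfolding u_def v_def by (rule binomial_add_Suc_right)
  have l: "shifted_coeff m (Suc k) = 2 * (2 ^ k / 4 ^ m) * y * u"
    using True by (simp add: shifted_coeff_def y_def u_def j_def)
  have "Suc j = m - k" using m by simp
  then have r: "shifted_coeff m k = 2 ^ k / 4 ^ m * x * v"
    using True unfolding shifted_coeff_def x_def v_def by simp
  have "(real k + 1) * (2 * real m - 2 * real k - 1) * shifted_coeff m (Suc k)
      = 2 ^ k / 4 ^ m * (2 * (2 * real j + 1) * y) * ((real k + 1) * u)"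
  proof -
    have "2 * real m - 2 * real k - 1 = 2 * real j + 1" by (simp add: m)
    then show ?thesis unfolding l by (simp only: mult_ac)
  qed
  also have "\<dots> = (real j + 1) * (real m + real k + 1) * (2 ^ k / 4 ^ m * x * v)"
    unfolding x[symmetric] u by (simp only: mult_ac)
  also have "real j + 1 = real m - real k" by (simp add: m)
  finally show ?thesis unfolding r .
next
  case False
  then show ?thesis by (cases "k = m") (simp_all add: shifted_coeff_def)
qed

text \<open>Step in m at index k + 1, split m + k + 2 = 2(k+1) + (m-k), turn the first part into a
  multiple of \<open>shifted_coeff m k\<close> by the step in k, and cancel m - k. This cancellation
  fails at k = m, which is computed directly.\<close>

lemma shifted_coeff_Suc_Suc:
  "2 * (real m + 1) * shifted_coeff (Suc m) (Suc k)
     = 2 * (real m + real k + 1) * shifted_coeff m k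
       + (2 * real m - 2 * real k - 1) * shifted_coeff m (Suc k)"
proof (cases "k = m")
  case True
  define x where "x = real ((2 * Suc m) choose Suc m)"
  have x: "(real m + 1) * x = 2 * (2 * real m + 1) * real ((2 * m) choose m)"
    unfolding x_def by (rule central_binomial_Suc)
  have "shifted_coeff (Suc m) (Suc m) = 2 ^ m / 4 ^ m / 2 * x"
  proof -
    have "Suc m + Suc m = 2 * Suc m" by simp
    then show ?thesis unfolding shifted_coeff_def x_def by (simp only:) simp
  qed
  then have "2 * (real m + 1) * shifted_coeff (Suc m) (Suc m) = 2 ^ m / 4 ^ m * ((real m + 1) * x)"
    by (simp add: field_simps)
  then show ?thesis
    unfolding x using True by (simp add: shifted_coeff_def mult_2[symmetric])
next
  case False
  have 1: "2 * (real m + 1) * (real m - real k) * shifted_coeff (Suc m) (Suc k)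
     = (2 * real m - 2 * real k - 1) * (real m + real k + 2) * shifted_coeff m (Suc k)"
    using shifted_coeff_Suc_left[of m "Suc k"] by (simp add: algebra_simps)
  have "(real m - real k) * (2 * (real m + 1) * shifted_coeff (Suc m) (Suc k))
     = (2 * real m - 2 * real k - 1) * (real m + real k + 2) * shifted_coeff m (Suc k)"
    unfolding 1[symmetric] by (simp only: mult_ac)
  also have "\<dots> = 2 * ((real k + 1) * (2 * real m - 2 * real k - 1) * shifted_coeff m (Suc k))
       + (real m - real k) * (2 * real m - 2 * real k - 1) * shifted_coeff m (Suc k)"
    by (simp add: algebra_simps)
  also have "\<dots> = (real m - real k) * (2 * (real m + real k + 1) * shifted_coeff m k
       + (2 * real m - 2 * real k - 1) * shifted_coeff m (Suc k))"
    unfolding shifted_coeff_Suc_right by (simp add: algebra_simps)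
  finally have "(real m - real k) * (2 * (real m + 1) * shifted_coeff (Suc m) (Suc k))
     = (real m - real k) * (2 * (real m + real k + 1) * shifted_coeff m k
       + (2 * real m - 2 * real k - 1) * shifted_coeff m (Suc k))" .
  moreover have "real m - real k \<noteq> 0" using False by simp
  ultimately show ?thesis by (metis mult_left_cancel)
qed

section \<open>Differential identities for Q_m and P_m\<close>

lemma shifted_poly_Suc:
  "smult (2 * (real m + 1)) (shifted_poly (Suc m))
     = [:2 * real m + 1, 2 * (real m + 1):] * shifted_poly m
       + [:0, -2, 2:] * pderiv (shifted_poly m)"
proof (rule poly_eqI)
  fix k
  show "coeff (smult (2 * (real m + 1)) (shifted_poly (Suc m))) k =
    coeff ([:2 * real m + 1, 2 * (real m + 1):] * shifted_poly m
       + [:0, -2, 2:] * pderiv (shifted_poly m)) k"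
  proof (cases k)
    case 0
    have "(real m + 1) * (2 * (real m + 1) * shifted_coeff (Suc m) 0)
      = (real m + 1) * ((2 * real m + 1) * shifted_coeff m 0)"
      using shifted_coeff_Suc_left[of m 0] by (simp add: algebra_simps)
    then have "2 * (real m + 1) * shifted_coeff (Suc m) 0 = (2 * real m + 1) * shifted_coeff m 0"
      by (metis mult_left_cancel of_nat_Suc of_nat_neq_0 add.commute)
    then show ?thesis using 0 by (simp add: coeff_shifted_poly)
  next
    case (Suc l)
    then show ?thesis using shifted_coeff_Suc_Suc[of m l]
      by (cases l) (simp_all add: coeff_shifted_poly coeff_pderiv algebra_simps)
  qed
qed

text \<open>Under x = a + 1 the left operator becomes (m+1) - a d/da, which multiplies the
  coefficient of a^i by m + 1 - i. On the right both derivative factors are divisible by x - 1, that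
  is by a, so that after the shift only d_i(m) and d_{i+1}(m) occur in the coefficient of
  a^i.\<close>

lemma shifted_poly_Suc_pderiv:
  "smult (2 * (real m + 1)) (smult (real m + 1) (shifted_poly (Suc m))
       - [:-1, 1:] * pderiv (shifted_poly (Suc m)))
     = smult ((4 * real m + 3) * (real m + 1)) (shifted_poly m)
       + [:1 - 2 * real m, 2 * real m - 1:] * pderiv (shifted_poly m)
       + [:0, 2, -2:] * pderiv (pderiv (shifted_poly m))"
proof (rule poly_eqI)
  fix k
  have 1: "2 * (real m + 1) * ((real m + 1 - real k) * shifted_coeff (Suc m) k
        + (real k + 1) * shifted_coeff (Suc m) (Suc k))
     = ((4 * real m + 3) * (real m + 1) + (2 * real m + 1) * real k - 2 * real k ^ 2)
         * shifted_coeff m k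
       - (real k + 1) * (2 * real m - 2 * real k - 1) * shifted_coeff m (Suc k)"
  proof -
    have "2 * (real m + 1) * ((real m + 1 - real k) * shifted_coeff (Suc m) k
        + (real k + 1) * shifted_coeff (Suc m) (Suc k))
      = 2 * (real m + 1) * (real m + 1 - real k) * shifted_coeff (Suc m) k
        + (real k + 1) * (2 * (real m + 1) * shifted_coeff (Suc m) (Suc k))"
      by (simp add: algebra_simps)
    also have "\<dots> = (2 * real m + 3) * (real m + real k + 1) * shifted_coeff m k
        + (real k + 1) * (2 * real m - 2 * real k - 1) * shifted_coeff m (Suc k)"
      unfolding shifted_coeff_Suc_left shifted_coeff_Suc_Suc by (simp add: algebra_simps)
    \<comment> \<open>Twice the recurrence in k is used to flip the sign of the last term; this
      choice of sign produces the divisibility by x - 1.\<close>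
    finally show ?thesis
      unfolding shifted_coeff_Suc_right by (simp add: algebra_simps power2_eq_square)
  qed
  show "coeff (smult (2 * (real m + 1)) (smult (real m + 1) (shifted_poly (Suc m))
       - [:-1, 1:] * pderiv (shifted_poly (Suc m)))) k =
    coeff (smult ((4 * real m + 3) * (real m + 1)) (shifted_poly m)
       + [:1 - 2 * real m, 2 * real m - 1:] * pderiv (shifted_poly m)
       + [:0, 2, -2:] * pderiv (pderiv (shifted_poly m))) k"
  proof (cases k)
    case 0
    then show ?thesis using 1 by (simp add: coeff_shifted_poly coeff_pderiv algebra_simps)
  next
    case (Suc l)
    then show ?thesis using 1
      by (cases l) (simp_all add: coeff_shifted_poly coeff_pderiv algebra_simps power2_eq_square)
  qed
qed

text \<open>The inner derivative is 1, so identities between Q_m and its derivatives carry over to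
  P_m.\<close>

lemma pderiv_pcompose_shift:
  "pderiv (pcompose p [:c, 1:]) = pcompose (pderiv p) [:c, 1:]" for p :: "real poly"
  by (simp add: pderiv_pcompose pderiv_pCons)

lemma boros_moll_poly_Suc:
  "smult (2 * (real m + 1)) (boros_moll_poly (Suc m))
     = [:4 * real m + 3, 2 * (real m + 1):] * boros_moll_poly m
       + [:0, 2, 2:] * pderiv (boros_moll_poly m)"
proof -
  have "pcompose [:2 * real m + 1, 2 * (real m + 1):] [:1, 1:] = [:4 * real m + 3, 2 * (real m + 1):]"
    "pcompose [:0, -2, 2:] [:1, 1 :: real:] = [:0, 2, 2:]"
    by (simp_all add: pcompose_pCons)
  then show ?thesis
    using arg_cong[OF shifted_poly_Suc[of m], of "\<lambda>p. pcompose p [:1, 1:]"]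
    by (simp only: pcompose_add pcompose_mult pcompose_smult pderiv_pcompose_shift
        boros_moll_poly_eq_pcompose)
qed

lemma boros_moll_poly_Suc_pderiv:
  "smult (2 * (real m + 1)) (smult (real m + 1) (boros_moll_poly (Suc m))
       - [:0, 1:] * pderiv (boros_moll_poly (Suc m)))
     = smult ((4 * real m + 3) * (real m + 1)) (boros_moll_poly m)
       + [:0, 2 * real m - 1:] * pderiv (boros_moll_poly m)
       + [:0, -2, -2:] * pderiv (pderiv (boros_moll_poly m))"
proof -
  have "pcompose [:-1, 1:] [:1, 1 :: real:] = [:0, 1:]"
    "pcompose [:1 - 2 * real m, 2 * real m - 1:] [:1, 1:] = [:0, 2 * real m - 1:]"
    "pcompose [:0, 2, -2:] [:1, 1 :: real:] = [:0, -2, -2:]"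
    by (simp_all add: pcompose_pCons)
  then show ?thesis
    using arg_cong[OF shifted_poly_Suc_pderiv[of m], of "\<lambda>p. pcompose p [:1, 1:]"]
    by (simp only: pcompose_add pcompose_diff pcompose_mult pcompose_smult pderiv_pcompose_shift
        boros_moll_poly_eq_pcompose)
qed

section \<open>Recurrences for d_i(m)\<close>

lemma boros_moll_coeff_Suc_Suc:
  "2 * (real m + 1) * boros_moll_coeff (Suc i) (Suc m)
     = 2 * (real m + real i + 1) * boros_moll_coeff i m
       + (4 * real m + 2 * real i + 5) * boros_moll_coeff (Suc i) m"
  using arg_cong[OF boros_moll_poly_Suc[of m], of "\<lambda>p. coeff p (Suc i)"]
  by (cases i) (simp_all add: boros_moll_coeff_def coeff_pderiv algebra_simps)

lemma boros_moll_coeff_Suc: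
  "2 * (real m + 1) * (real m + 1 - real i) * boros_moll_coeff i (Suc m)
     = (4 * real m - 2 * real i + 3) * (real m + real i + 1) * boros_moll_coeff i m
       - 2 * real i * (real i + 1) * boros_moll_coeff (Suc i) m"
proof (cases i)
  case 0
  then show ?thesis
    using arg_cong[OF boros_moll_poly_Suc_pderiv[of m], of "\<lambda>p. coeff p i"]
    by (simp add: boros_moll_coeff_def coeff_pderiv algebra_simps)
next
  case (Suc l)
  then show ?thesis
    using arg_cong[OF boros_moll_poly_Suc_pderiv[of m], of "\<lambda>p. coeff p i"]
    by (cases l) (simp_all add: boros_moll_coeff_def coeff_pderiv algebra_simps)
qed

lemma boros_moll_coeff_three_term:
  "4 * (real m + 2 - real i) * (real m + 1) * (real m + 2) * boros_moll_coeff i (Suc (Suc m))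
     = 2 * (real m + 1) * (8 * real m ^ 2 + 24 * real m + 19 - 4 * real i ^ 2)
         * boros_moll_coeff i (Suc m)
       - (real m + real i + 1) * (4 * real m + 3) * (4 * real m + 5) * boros_moll_coeff i m"
proof -
  \<comment> \<open>The term to be eliminated: stepping m at m + 1 brings in d_{i+1}(m+1), the mixed
    recurrence trades it for d_i(m) and d_{i+1}(m), and the latter is expressed through d_i(m) and
    d_i(m+1).\<close>
  define e where "e = 2 * real i * (real i + 1) * boros_moll_coeff (Suc i) m"
  have e: "e = (4 * real m - 2 * real i + 3) * (real m + real i + 1) * boros_moll_coeff i m
      - 2 * (real m + 1) * (real m + 1 - real i) * boros_moll_coeff i (Suc m)"
    unfolding boros_moll_coeff_Suc e_def by simp
  have 1: "2 * (real m + 2) * (real m + 2 - real i) * boros_moll_coeff i (Suc (Suc m))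
     = (4 * real m - 2 * real i + 7) * (real m + real i + 2) * boros_moll_coeff i (Suc m)
       - 2 * real i * (real i + 1) * boros_moll_coeff (Suc i) (Suc m)"
    using boros_moll_coeff_Suc[of "Suc m" i] by (simp add: algebra_simps)
  have "4 * (real m + 2 - real i) * (real m + 1) * (real m + 2) * boros_moll_coeff i (Suc (Suc m))
     = 2 * (real m + 1)
         * (2 * (real m + 2) * (real m + 2 - real i) * boros_moll_coeff i (Suc (Suc m)))"
    by (simp add: algebra_simps)
  also have "\<dots> = 2 * (real m + 1) * (4 * real m - 2 * real i + 7) * (real m + real i + 2)
         * boros_moll_coeff i (Suc m)
       - 2 * real i * (real i + 1) * (2 * (real m + 1) * boros_moll_coeff (Suc i) (Suc m))"
    unfolding 1 by (simp add: algebra_simps)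
  also have "\<dots> = 2 * (real m + 1) * (4 * real m - 2 * real i + 7) * (real m + real i + 2)
         * boros_moll_coeff i (Suc m)
       - 4 * real i * (real i + 1) * (real m + real i + 1) * boros_moll_coeff i m
       - (4 * real m + 2 * real i + 5) * e"
    unfolding boros_moll_coeff_Suc_Suc e_def by (simp add: algebra_simps)
  finally show ?thesis
    unfolding e by (simp add: algebra_simps power2_eq_square)
qed

section \<open>The ratio bound\<close>

lemma boros_moll_coeff_eq_0: "boros_moll_coeff (Suc m) m = 0"
  by (auto simp: boros_moll_coeff_explicit intro!: sum.neutral)

text \<open>At i = 0 the factor i removes the d_{i+1}(m) term from
  \<open>boros_moll_coeff_Suc\<close>.\<close>

lemma ratio_eq_T_bound_0: "boros_moll_coeff 0 (Suc m) / boros_moll_coeff 0 m = T_bound m 0"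
proof -
  have "4 * real m ^ 2 + 7 * real m + 3 = (4 * real m + 3) * (real m + 1)"
    by (simp add: power2_eq_square algebra_simps)
  then have "T_bound m 0 = (4 * real m + 3) * (real m + 1) / (2 * (real m + 1) * (real m + 1))"
    by (simp add: T_bound_def)
  moreover have "2 * (real m + 1) * (real m + 1) * boros_moll_coeff 0 (Suc m)
      = (4 * real m + 3) * (real m + 1) * boros_moll_coeff 0 m"
    using boros_moll_coeff_Suc[of m 0] by simp
  ultimately show ?thesis
    using boros_moll_coeff_pos[of 0 m] by (simp add: frac_eq_eq mult_ac)
qed

lemma ratio_eq_T_bound_diag: "boros_moll_coeff m (Suc m) / boros_moll_coeff m m = T_bound m m"
proof -
  have "4 * real m + 4 * real m ^ 2 + 1 = (2 * real m + 1) ^ 2"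
    by (simp add: power2_eq_square algebra_simps)
  then have s: "sqrt (4 * real m + 4 * real m ^ 2 + 1) = 2 * real m + 1"
    by simp
  show ?thesis
    using boros_moll_coeff_Suc[of m m] boros_moll_coeff_pos[of m m]
    unfolding T_bound_def s
    by (simp add: boros_moll_coeff_eq_0 divide_simps power2_eq_square) (simp add: algebra_simps)
qed

text \<open>
  Here $n = m + 1$; over the common denominator $2(m+2-i)(m+2)$, the first factor on the left is the
  numerator of $A(m) - T(m+1,i)$; the second one is the numerator of $T(m,i)$.
\<close>

lemma sqrt_step_inequality:
  fixes n i :: real
  assumes i: "1 \<le> i" and n: "i + 1 \<le> n"
  defines "s \<equiv> sqrt (4 * n + 4 * i ^ 2 - 3)" and "s' \<equiv> sqrt (4 * n + 4 * i ^ 2 + 1)"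
  shows "(4 * n ^ 2 + n - 2 * i ^ 2 - i * s') * (4 * n ^ 2 - n - 2 * i ^ 2 + i * s)
           < (n ^ 2 - i ^ 2) * (16 * n ^ 2 - 1)"
proof -
  have i2: "i ^ 2 \<ge> 0" by simp
  have ss: "s ^ 2 = 4 * n + 4 * i ^ 2 - 3" unfolding s_def
    by (rule real_sqrt_pow2) (use i n i2 in linarith)
  have ss': "s' ^ 2 = 4 * n + 4 * i ^ 2 + 1" unfolding s'_def
    by (rule real_sqrt_pow2) (use i n i2 in linarith)
  have s'_pos: "s' > 0" unfolding s'_def using i n i2 by (intro real_sqrt_gt_zero) linarith
  \<comment> \<open>Since i <= n - 1 and n >= 2, this gives s'^2 <= 4n^2 - 4n + 5 <= 4n^2, hence i
    s' <= 2n^2 and positivity of the first factor.\<close>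
  have i_sq: "i ^ 2 \<le> (n - 1) ^ 2" using i n by (intro power_mono) auto
  have "s' ^ 2 \<le> (2 * n) ^ 2"
    using ss' i_sq n i by (simp add: power2_eq_square algebra_simps)
  then have "s' \<le> 2 * n" by (rule power2_le_imp_le) (use i n in auto)
  then have "i * s' \<le> n * (2 * n)" using i n s'_pos by (intro mult_mono) auto
  moreover have "i ^ 2 \<le> n ^ 2" using i n by (intro power_mono) auto
  ultimately have P: "4 * n ^ 2 + n - 2 * i ^ 2 - i * s' > 0"
    using i n by (simp add: power2_eq_square)
  \<comment> \<open>Here s^2 = s'^2 - 4, while squaring s' - 2/s' leaves the extra positive term
    4/s'^2.\<close>
  have sq_gap: "s ^ 2 < (s' - 2 / s') ^ 2"
  proof -
    have "(s' - 2 / s') ^ 2 = s' ^ 2 - 4 + (2 / s') ^ 2"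
      using s'_pos by (simp add: power2_diff)
    then show ?thesis using ss ss' s'_pos by simp
  qed
  have "2 \<le> s' ^ 2" using ss' i n i2 by linarith
  then have "0 \<le> s' - 2 / s'" using s'_pos by (simp add: field_simps power2_eq_square)
  with sq_gap have "s < s' - 2 / s'" by (rule power2_less_imp_less)
  then have "s * s' < (s' - 2 / s') * s'" using s'_pos by (rule mult_strict_right_mono)
  then have gap: "s * s' < s' ^ 2 - 2" using s'_pos by (simp add: algebra_simps power2_eq_square)
  have "((2 * n + 1) * i) ^ 2 \<le> (n * s') ^ 2"
  proof -
    have "(n * s') ^ 2 - ((2 * n + 1) * i) ^ 2 = (4 * n + 1) * (n ^ 2 - i ^ 2)"
      unfolding power_mult_distrib ss' by (simp add: power2_eq_square algebra_simps)
    also have "\<dots> \<ge> 0" using \<open>i ^ 2 \<le> n ^ 2\<close> i n by (intro mult_nonneg_nonneg) auto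
    finally show ?thesis by simp
  qed
  then have key: "(2 * n + 1) * i \<le> n * s'"
    by (rule power2_le_imp_le) (use i n s'_pos in auto)
  define P where "P = 4 * n ^ 2 + n - 2 * i ^ 2"
  define Q where "Q = 4 * n ^ 2 - n - 2 * i ^ 2"
  \<comment> \<open>Since P Q - (n^2 - i^2)(16n^2 - 1) = 4i^4 - i^2, the goal is i times the
    inequality (P - i s') s < Q s' - 4i^3 + i. That one is proved after multiplication by s', where
    s s' < s'^2 - 2 applies and the remainder is nonpositive by \<open>key\<close>.\<close>
  have "(P - i * s') * (s * s') < (P - i * s') * (s' ^ 2 - 2)"
    using gap P unfolding P_def by (intro mult_strict_left_mono) auto
  also have "\<dots> = (Q * s' - 4 * i ^ 3 + i) * s' + 4 * i * ((2 * n + 1) * i - n * s')"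
  proof -
    have "(Q * s' - 4 * i ^ 3 + i) * s' = Q * s' ^ 2 - (4 * i ^ 3 - i) * s'"
      by (simp add: algebra_simps power2_eq_square)
    then show ?thesis unfolding P_def Q_def ss'
      by (simp add: algebra_simps power2_eq_square power3_eq_cube)
  qed
  also have "\<dots> \<le> (Q * s' - 4 * i ^ 3 + i) * s'"
    using key i by (simp add: mult_nonneg_nonpos)
  finally have "((P - i * s') * s) * s' < (Q * s' - 4 * i ^ 3 + i) * s'"
    by (simp add: mult.assoc)
  then have "(P - i * s') * s < Q * s' - 4 * i ^ 3 + i"
    using s'_pos by simp
  then have "i * ((P - i * s') * s - (Q * s' - 4 * i ^ 3 + i)) < 0"
    using i by (intro mult_pos_neg) auto
  moreover have "i * ((P - i * s') * s - (Q * s' - 4 * i ^ 3 + i))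
      = (P - i * s') * (Q + i * s) - (n ^ 2 - i ^ 2) * (16 * n ^ 2 - 1)"
    unfolding P_def Q_def by (simp add: algebra_simps power2_eq_square power3_eq_cube)
  ultimately show ?thesis unfolding P_def Q_def by simp
qed

text \<open>One induction step of the bound. The hypothesis is nonstrict so that the equality at m =
  i can start the induction, and the conclusion is strict because
  \<open>sqrt_step_inequality\<close> is.\<close>

lemma ratio_step:
  assumes i: "1 \<le> i" "i \<le> m"
    and le: "boros_moll_coeff i (Suc m) / boros_moll_coeff i m \<le> T_bound m i"
  shows "boros_moll_coeff i (Suc (Suc m)) / boros_moll_coeff i (Suc m) < T_bound (Suc m) i"
proof -
  define x where "x = real i"
  define n where "n = real m + 1"
  define s where "s = sqrt (4 * n + 4 * x ^ 2 - 3)"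
  define s' where "s' = sqrt (4 * n + 4 * x ^ 2 + 1)"
  \<comment> \<open>\<open>N\<close> is the numerator of T(m,i), and \<open>M\<close> that of A(m) -
    T(m+1,i).\<close>
  define N where "N = 4 * n ^ 2 - n - 2 * x ^ 2 + x * s"
  define M where "M = 4 * n ^ 2 + n - 2 * x ^ 2 - x * s'"
  define d0 where "d0 = boros_moll_coeff i m"
  define d1 where "d1 = boros_moll_coeff i (Suc m)"
  define d2 where "d2 = boros_moll_coeff i (Suc (Suc m))"
  have x: "1 \<le> x" "x + 1 \<le> n" using i by (auto simp: x_def n_def)
  have pos: "d0 > 0" "d1 > 0"
    using i by (auto simp: d0_def d1_def intro: boros_moll_coeff_pos)
  have T: "T_bound m i = N / (2 * (n - x) * n)"
    unfolding T_bound_def N_def s_def x_def n_def by (simp add: power2_eq_square algebra_simps)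
  have T': "T_bound (Suc m) i = (8 * n ^ 2 + 8 * n + 3 - 4 * x ^ 2 - M) / (2 * (n + 1 - x) * (n + 1))"
    unfolding T_bound_def M_def s'_def x_def n_def by (simp add: power2_eq_square algebra_simps)
  have rec: "4 * (n + 1 - x) * n * (n + 1) * d2
     = 2 * n * (8 * n ^ 2 + 8 * n + 3 - 4 * x ^ 2) * d1 - (n + x) * (16 * n ^ 2 - 1) * d0"
    using boros_moll_coeff_three_term[of m i]
    unfolding d0_def d1_def d2_def x_def n_def by (simp add: power2_eq_square algebra_simps)
  have MN: "M * N < (n ^ 2 - x ^ 2) * (16 * n ^ 2 - 1)"
    unfolding M_def N_def s_def s'_def by (rule sqrt_step_inequality) (use x in auto)
  have nx: "n - x > 0" "n > 0" using x by auto
  have d1_le: "2 * (n - x) * n * d1 \<le> N * d0"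
    using le pos nx unfolding T d0_def[symmetric] d1_def[symmetric]
    by (simp add: divide_simps mult_ac)
  have "2 * (n - x) * n * d1 > 0" using nx pos by simp
  with d1_le have "N * d0 > 0" by linarith
  then have N: "N > 0" using pos by (simp add: zero_less_mult_iff)
  have R: "(n + x) * (16 * n ^ 2 - 1) > 0"
  proof -
    have "n ^ 2 \<ge> 1" using x by simp
    then have "16 * n ^ 2 - 1 > 0" by linarith
    then show ?thesis using x by (intro mult_pos_pos) auto
  qed
  \<comment> \<open>This is A(m) - T(m+1,i) < B(m)/r(m) without quotients. The extra factor
    \<open>N\<close> lets the bound on M N and the hypothesis 2(n-x) n d1 <= N d0 be chained through
    n^2 - x^2 = (n+x)(n-x).\<close>
  have "M * (2 * n * d1) * N < (n + x) * (16 * n ^ 2 - 1) * d0 * N"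
  proof -
    have "(M * N) * (2 * n * d1) < ((n ^ 2 - x ^ 2) * (16 * n ^ 2 - 1)) * (2 * n * d1)"
      using MN nx pos by (intro mult_strict_right_mono) auto
    also have "\<dots> = ((n + x) * (16 * n ^ 2 - 1)) * (2 * (n - x) * n * d1)"
      by (simp add: algebra_simps power2_eq_square)
    also have "\<dots> \<le> ((n + x) * (16 * n ^ 2 - 1)) * (N * d0)"
      using d1_le R by (intro mult_left_mono) auto
    finally show ?thesis by (simp add: mult_ac)
  qed
  then have "M * (2 * n * d1) < (n + x) * (16 * n ^ 2 - 1) * d0" using N by simp
  then have "(2 * n) * (2 * (n + 1 - x) * (n + 1) * d2)
      < (2 * n) * ((8 * n ^ 2 + 8 * n + 3 - 4 * x ^ 2 - M) * d1)"
    using rec by (simp add: algebra_simps)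
  then have "2 * (n + 1 - x) * (n + 1) * d2 < (8 * n ^ 2 + 8 * n + 3 - 4 * x ^ 2 - M) * d1"
    using nx by simp
  moreover have "2 * (n + 1 - x) * (n + 1) > 0" using nx by simp
  ultimately show ?thesis
    unfolding T' d1_def[symmetric] d2_def[symmetric] using pos
    by (simp add: pos_less_divide_eq pos_divide_less_eq mult_ac)
qed

lemma ratio_less_T_bound:
  assumes "1 \<le> i" "Suc i \<le> m"
  shows "boros_moll_coeff i (Suc m) / boros_moll_coeff i m < T_bound m i"
  using assms(2)
\<comment> \<open>The induction starts at m = i + 1, which \<open>ratio_step\<close> reaches from
  the equality at m = i.\<close>
proof (induction m rule: dec_induct)
  case base
  show ?case using ratio_step[of i i] assms(1) by (simp add: ratio_eq_T_bound_diag)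
next
  case (step m)
  then show ?case using ratio_step[of i m] assms(1) by simp
qed

theorem theorem2p1:
  shows "(\<forall>m i. m \<ge> 2 \<and> 1 \<le> i \<and> i \<le> m - 1 \<longrightarrow>
            boros_moll_coeff i (m + 1) / boros_moll_coeff i m < T_bound m i)
       \<and> (\<forall>m\<ge>1. boros_moll_coeff 0 (m + 1) / boros_moll_coeff 0 m = T_bound m 0
            \<and> boros_moll_coeff m (m + 1) / boros_moll_coeff m m = T_bound m m)"
  using ratio_less_T_bound ratio_eq_T_bound_0 ratio_eq_T_bound_diag by auto

end
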